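(* For every $n\ge2$, the number of rectangular ascending polyominoes of semi-perimeter $n$ is $\binom{2n-4}{n-2}$; equivalently their generating function by semi-perimeter is $\dfrac{t^2}{\sqrt{1-4t}}$.
   Context: A polyomino is a finite edge-connected set of unit cells; it is convex if every row and column is a contiguous segment; its semi-perimeter is the width plus the height of its minimal bounding rectangle. A NW-path inside $P$ is a sequence of cells of $P$, consecutive cells sharing an edge, each step North or West; write $a\nwarrow b$ if such a path exists, let $D_{NW}(a,b)$ be the minimum number of direction changes over such paths, and $D_{NW}(P)=\max\{D_{NW}(a,b):a\nwarrow b\}$. A convex polyomino is ascending if $D_{NW}(P)\le1$. An ascending polyomino $P$ is rectangular if the topmost cell of its rightmost column attains the maximum height among all cells of $P$. *)

theory Defs
  imports "HOL-Computational_Algebra.Formal_Power_Series"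
begin

text \<open>The cell \<open>(x, y)\<close> is the unit square with lower left corner \<open>(x, y)\<close>;
  x grows to the East and y to the North.\<close>

type_synonym cell = "int \<times> int"

definition edge_adjacent :: "cell \<Rightarrow> cell \<Rightarrow> bool" where
  "edge_adjacent a b \<longleftrightarrow> \<bar>fst a - fst b\<bar> + \<bar>snd a - snd b\<bar> = 1"

definition edge_connected :: "cell set \<Rightarrow> bool" where
  "edge_connected P \<longleftrightarrow>
     (\<forall>a\<in>P. \<forall>b\<in>P. (a, b) \<in> {(u, v). u \<in> P \<and> v \<in> P \<and> edge_adjacent u v}\<^sup>*)"

definition polyomino :: "cell set \<Rightarrow> bool" where
  "polyomino P \<longleftrightarrow> finite P \<and> P \<noteq> {} \<and> edge_connected P"

text \<open>Rows and columns that miss \<open>P\<close> are covered by the empty intervals with \<open>l > r\<close>.\<close>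

definition convex_polyomino :: "cell set \<Rightarrow> bool" where
  "convex_polyomino P \<longleftrightarrow> polyomino P \<and>
     (\<forall>y. \<exists>l r. {x. (x, y) \<in> P} = {l..r}) \<and>
     (\<forall>x. \<exists>l r. {y. (x, y) \<in> P} = {l..r})"

definition width :: "cell set \<Rightarrow> nat" where
  "width P = nat (Max (fst ` P) - Min (fst ` P) + 1)"

definition height :: "cell set \<Rightarrow> nat" where
  "height P = nat (Max (snd ` P) - Min (snd ` P) + 1)"

definition semi_perimeter :: "cell set \<Rightarrow> nat" where
  "semi_perimeter P = width P + height P"

definition north_step :: "cell \<Rightarrow> cell \<Rightarrow> bool" where
  "north_step a b \<longleftrightarrow> fst b = fst a \<and> snd b = snd a + 1"

definition west_step :: "cell \<Rightarrow> cell \<Rightarrow> bool" where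
  "west_step a b \<longleftrightarrow> fst b = fst a - 1 \<and> snd b = snd a"

text \<open>A one-cell path (no steps) is allowed, so every cell of \<open>P\<close> is reachable from itself.\<close>

definition nw_path :: "cell set \<Rightarrow> cell \<Rightarrow> cell \<Rightarrow> cell list \<Rightarrow> bool" where
  "nw_path P a b p \<longleftrightarrow> p \<noteq> [] \<and> hd p = a \<and> last p = b \<and> set p \<subseteq> P \<and>
     successively (\<lambda>u v. north_step u v \<or> west_step u v) p"

definition nw_reachable :: "cell set \<Rightarrow> cell \<Rightarrow> cell \<Rightarrow> bool" where
  "nw_reachable P a b \<longleftrightarrow> (\<exists>p. nw_path P a b p)"

text \<open>Every step of a NW-path is either North or West, so the direction changes at a cell
  iff exactly one of the two steps meeting there is North.\<close>

definition direction_changes :: "cell list \<Rightarrow> nat" where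
  "direction_changes p =
     card {i. i + 2 < length p \<and>
       north_step (p ! i) (p ! (i + 1)) \<noteq> north_step (p ! (i + 1)) (p ! (i + 2))}"

definition D_NW_cells :: "cell set \<Rightarrow> cell \<Rightarrow> cell \<Rightarrow> nat" where
  "D_NW_cells P a b = (LEAST k. \<exists>p. nw_path P a b p \<and> direction_changes p = k)"

definition D_NW :: "cell set \<Rightarrow> nat" where
  "D_NW P = Max {D_NW_cells P a b | a b. nw_reachable P a b}"

definition ascending :: "cell set \<Rightarrow> bool" where
  "ascending P \<longleftrightarrow> convex_polyomino P \<and> D_NW P \<le> 1"

definition rightmost_column_top :: "cell set \<Rightarrow> int" where
  "rightmost_column_top P = Max {y. (Max (fst ` P), y) \<in> P}"

definition rectangular_ascending :: "cell set \<Rightarrow> bool" where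
  "rectangular_ascending P \<longleftrightarrow> ascending P \<and> rightmost_column_top P = Max (snd ` P)"

text \<open>Polyominoes are counted up to translation.\<close>

definition translation_rel :: "cell set rel" where
  "translation_rel = {(P, Q). \<exists>d e. Q = (\<lambda>(x, y). (x + d, y + e)) ` P}"

definition num_rectangular_ascending :: "nat \<Rightarrow> nat" where
  "num_rectangular_ascending n =
     card ({P. rectangular_ascending P \<and> semi_perimeter P = n} // translation_rel)"

definition rectangular_ascending_gf :: "real fps" where
  "rectangular_ascending_gf = Abs_fps (\<lambda>n. of_nat (num_rectangular_ascending n))"

end

theory Submission
  imports Defs
begin

text \<open>Read from right to left, the columns of a convex polyomino containing the north-east corner of its
  bounding box are intervals of depths below the top row whose upper ends weakly increase, whose lower
  ends are unimodal, and which overlap consecutively; conversely every such sequence of intervals is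
  a polyomino of this kind.  The monotone upper ends make it automatically ascending: a cell that
  reaches another one to the north-west can go all the way north and then west.

  Let \<open>S\<close> be the number of sequences with a box of \<open>W + 1\<close> columns and \<open>h\<close> rows whose first column has
  height at least \<open>c\<close>.  Cutting off the first column gives recurrences in \<open>W\<close>, \<open>h\<close>, \<open>c\<close> that amount to
  Pascal's rule for \<open>S = \<Sum>k. \<plusminus> (W + h - 1 choose k) (W + h - c choose 2 W - k)\<close>, with the plus sign iff
  \<open>k \<ge> W\<close>.  For \<open>c = 1\<close> the terms cancel in pairs except for \<open>k = W\<close>, so each box contributes
  \<open>(W + h - 1 choose W)\<^sup>2\<close>, and these squares add up to the central binomial coefficient.\<close>

subsection \<open>Signed Vandermonde sums\<close>

text \<open>This is the coefficient of \<open>z ^ r\<close> in the product of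
  \<open>(1 + z) ^ q\<close> with \<open>(1 + z) ^ a\<close>, where the terms of the latter of
  degree below \<open>p\<close> are negated.\<close>

definition signed_vandermonde :: "nat \<Rightarrow> nat \<Rightarrow> nat \<Rightarrow> nat \<Rightarrow> int" where
  "signed_vandermonde p a q r =
     (\<Sum>k\<le>r. (if p \<le> k then 1 else - 1) * int (a choose k) * int (q choose (r - k)))"

lemma signed_vandermonde_Suc_right:
  "signed_vandermonde p a (Suc q) (Suc r) =
     signed_vandermonde p a q (Suc r) + signed_vandermonde p a q r"
proof -
  have "signed_vandermonde p a (Suc q) (Suc r) =
      (\<Sum>k\<le>r. (if p \<le> k then 1 else - 1) * int (a choose k) * int (Suc q choose Suc (r - k)))
      + (if p \<le> Suc r then 1 else - 1) * int (a choose Suc r)"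
    unfolding signed_vandermonde_def by (auto simp: Suc_diff_le intro!: sum.cong)
  also have "\<dots> = signed_vandermonde p a q (Suc r) + signed_vandermonde p a q r"
    unfolding signed_vandermonde_def
    by (auto simp: Suc_diff_le algebra_simps simp flip: sum.distrib intro!: sum.cong)
  finally show ?thesis .
qed

text \<open>One half of Pascal's rule lowers \<open>k\<close> by one, and the sign threshold drops
  from \<open>Suc p\<close> to \<open>p\<close> with it.\<close>

lemma signed_vandermonde_Suc_left:
  "signed_vandermonde (Suc p) (Suc a) q (Suc r) =
     signed_vandermonde (Suc p) a q (Suc r) + signed_vandermonde p a q r"
  unfolding signed_vandermonde_def sum.atMost_Suc_shift
  by (simp add: algebra_simps flip: sum.distrib)

text \<open>The reflections \<open>k \<mapsto> 2 * p + 1 - k\<close> and \<open>k \<mapsto> 2 * p - k\<close> exchange terms of opposite sign.\<close>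

lemma signed_vandermonde_antisym: "signed_vandermonde (Suc p) a a (2 * p + 1) = 0"
proof -
  let ?f = "\<lambda>k. (if Suc p \<le> k then 1 else - 1) * int (a choose k) * int (a choose (2 * p + 1 - k))"
  have "sum ?f {..2 * p + 1} = (\<Sum>k\<le>2 * p + 1. ?f (2 * p + 1 - k))"
    by (rule sum.nat_diff_reindex[of _ "Suc (2 * p + 1)", symmetric, simplified lessThan_Suc_atMost diff_Suc_Suc])
  also have "\<dots> = (\<Sum>k\<le>2 * p + 1. - ?f k)"
    by (intro sum.cong) auto
  finally show ?thesis
    unfolding signed_vandermonde_def by (simp add: sum_negf)
qed

lemma signed_vandermonde_square: "signed_vandermonde p a a (2 * p) = int (a choose p) ^ 2"
proof -
  let ?f = "\<lambda>k. (if p \<le> k then 1 else - 1) * int (a choose k) * int (a choose (2 * p - k))"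
  let ?g = "\<lambda>k. (if k = p then int (a choose p) ^ 2 else 0)"
  have "sum ?f {..2 * p} = (\<Sum>k\<le>2 * p. ?f (2 * p - k))"
    by (rule sum.nat_diff_reindex[of _ "Suc (2 * p)", symmetric, simplified lessThan_Suc_atMost diff_Suc_Suc])
  \<comment> \<open>The fixed point \<open>k = p\<close> has no partner: every other term cancels
    against its mirror image, the middle one is counted twice.\<close>
  also have "\<dots> = (\<Sum>k\<le>2 * p. 2 * ?g k - ?f k)"
    by (intro sum.cong) (auto simp: power2_eq_square)
  finally have "2 * sum ?f {..2 * p} = (\<Sum>k\<le>2 * p. 2 * ?g k)"
    by (simp add: sum_subtractf)
  then show ?thesis
    unfolding signed_vandermonde_def by (simp flip: sum_distrib_left)
qed

text \<open>For \<open>k < p\<close> the factor \<open>p choose (2 * p - k)\<close> vanishes, so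
  only positive signs survive and Vandermonde's identity applies.\<close>

lemma signed_vandermonde_positive:
  "signed_vandermonde p a p (2 * p) = int ((a + p) choose (2 * p))"
proof -
  have "signed_vandermonde p a p (2 * p) =
      (\<Sum>k\<le>2 * p. int (a choose k) * int (p choose (2 * p - k)))"
    unfolding signed_vandermonde_def by (intro sum.cong) auto
  then show ?thesis
    by (simp add: vandermonde[of a p, symmetric])
qed

subsection \<open>Counting column sequences\<close>

text \<open>Both predicates describe the columns \<open>xs\<close> following a column that occupies the depths \<open>b\<close> to \<open>t\<close>;
  \<open>columns_from H\<close> additionally requires that the deepest cell has depth \<open>H\<close>.  Once depth \<open>H\<close> is
  reached, unimodality of the lower ends leaves only nested columns.\<close>

fun nested_columns :: "nat \<Rightarrow> nat \<Rightarrow> (nat \<times> nat) list \<Rightarrow> bool" where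
  "nested_columns b t [] \<longleftrightarrow> b \<le> t"
| "nested_columns b t ((b', t') # xs) \<longleftrightarrow> b \<le> b' \<and> t' \<le> t \<and> nested_columns b' t' xs"

fun columns_from :: "nat \<Rightarrow> nat \<Rightarrow> nat \<Rightarrow> (nat \<times> nat) list \<Rightarrow> bool" where
  "columns_from H b t [] \<longleftrightarrow> b \<le> t \<and> t = H"
| "columns_from H b t ((b', t') # xs) \<longleftrightarrow>
     (if t = H then nested_columns b t ((b', t') # xs)
      else b \<le> b' \<and> b' \<le> t \<and> t \<le> t' \<and> columns_from H b' t' xs)"

text \<open>The recursion checks nonemptiness only at the last column; the chain of nested ends
  carries it back to the first.\<close>

lemma nested_columns_le: "nested_columns b t xs \<Longrightarrow> b \<le> t"
  by (induction b t xs rule: nested_columns.induct) auto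

lemma columns_from_le: "columns_from H b t xs \<Longrightarrow> b \<le> t \<and> t \<le> H"
  by (induction H b t xs rule: columns_from.induct) (auto dest: nested_columns_le split: if_splits)

lemma columns_from_full: "columns_from H b H xs \<longleftrightarrow> nested_columns b H xs"
  by (cases xs) auto

text \<open>Splitting off the head is a bijection onto a dependent sum over \<open>X\<close>. Both
  column predicates are counted this way.\<close>

lemma card_Cons:
  assumes "finite X" and "\<And>x. x \<in> X \<Longrightarrow> finite {xs. length xs = W \<and> R x xs}"
    and "\<And>x xs. Q (x # xs) \<longleftrightarrow> x \<in> X \<and> R x xs"
  shows "finite {xs. length xs = Suc W \<and> Q xs}"
    and "card {xs. length xs = Suc W \<and> Q xs} = (\<Sum>x\<in>X. card {xs. length xs = W \<and> R x xs})"
proof -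
  have eq: "{xs. length xs = Suc W \<and> Q xs} =
      (\<lambda>(x, xs). x # xs) ` (SIGMA x:X. {xs. length xs = W \<and> R x xs})"
    using assms(3) by (auto simp: length_Suc_conv image_iff)
  show "finite {xs. length xs = Suc W \<and> Q xs}"
    unfolding eq using assms(1,2) by (intro finite_imageI finite_SigmaI) auto
  show "card {xs. length xs = Suc W \<and> Q xs} = (\<Sum>x\<in>X. card {xs. length xs = W \<and> R x xs})"
    unfolding eq using assms(1,2) by (subst card_image) (auto simp: inj_on_def card_SigmaI)
qed

text \<open>Hockey-stick identity. The case \<open>b = Suc t\<close> is the empty sum, where
  \<open>m choose Suc m\<close> is 0.\<close>

lemma sum_choose_shifted:
  assumes "b \<le> Suc t"
  shows "(\<Sum>s = b..t. (m + (s - b)) choose m) = (m + (Suc t - b)) choose Suc m"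
  using assms
proof (induction t)
  case 0
  then show ?case by (cases "b = 0") auto
next
  case (Suc t)
  then show ?case
    by (cases "b \<le> Suc t") (auto simp: Suc_diff_le)
qed

lemma sum_choose_shifted':
  assumes "b \<le> Suc t"
  shows "(\<Sum>s = b..t. (m + (t - s)) choose m) = (m + (Suc t - b)) choose Suc m"
  using sum_choose_shifted[OF assms, of m]
  by (subst sum.atLeastAtMost_rev) (auto intro!: sum.cong arg_cong2[of _ _ _ _ binomial])

text \<open>The upper ends read forwards, followed by the lower ends read backwards, form a weakly
  increasing chain of \<open>2 * W\<close> numbers in \<open>{b..t}\<close>, that is, a multiset of
  this size over \<open>t - b + 1\<close> values.\<close>

lemma card_nested_columns:
  "finite {xs. length xs = W \<and> nested_columns b t xs} \<and>
   (b \<le> t \<longrightarrow> card {xs. length xs = W \<and> nested_columns b t xs} = (2 * W + (t - b)) choose (2 * W))"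
proof (induction W arbitrary: b t)
  case 0
  show ?case by (simp cong: conj_cong)
next
  case (Suc W)
  let ?X = "SIGMA b':{b..t}. {b'..t}"
  have step: "nested_columns b t (x # xs) \<longleftrightarrow> x \<in> ?X \<and> nested_columns (fst x) (snd x) xs" for x xs
    by (cases x) (auto dest: nested_columns_le)
  have fin: "finite ?X" by auto
  note C = card_Cons[where X = ?X and R = "\<lambda>x. nested_columns (fst x) (snd x)" and Q = "nested_columns b t",
      OF fin conjunct1[OF Suc.IH] step]
  have "card {xs. length xs = Suc W \<and> nested_columns b t xs} =
      (2 * Suc W + (t - b)) choose (2 * Suc W)" if "b \<le> t"
  proof -
    have "card {xs. length xs = Suc W \<and> nested_columns b t xs} =
        (\<Sum>x\<in>?X. (2 * W + (snd x - fst x)) choose (2 * W))"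
      unfolding C(2) using Suc.IH by (intro sum.cong refl) auto
    \<comment> \<open>The hockey-stick identity is used twice, first over the lower ends and then
      over the upper ends; each use raises the lower index by one.\<close>
    also have "\<dots> = (\<Sum>b' = b..t. \<Sum>t' = b'..t. (2 * W + (t' - b')) choose (2 * W))"
      by (subst sum.Sigma) (auto simp: case_prod_beta)
    also have "\<dots> = (\<Sum>b' = b..t. (Suc (2 * W) + (t - b')) choose Suc (2 * W))"
      by (intro sum.cong refl, subst sum_choose_shifted) (auto simp: Suc_diff_le simp del: binomial_Suc_Suc)
    also have "\<dots> = (Suc (2 * W) + (Suc t - b)) choose Suc (Suc (2 * W))"
      using that by (intro sum_choose_shifted') auto
    also have "\<dots> = (2 * Suc W + (t - b)) choose (2 * Suc W)"
      using that by (simp add: Suc_diff_le)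
    finally show ?thesis .
  qed
  with C(1) show ?case by blast
qed

section \<open>Tails reaching a prescribed depth\<close>

abbreviation column_tails :: "nat \<Rightarrow> nat \<Rightarrow> nat \<Rightarrow> nat \<Rightarrow> (nat \<times> nat) list set" where
  "column_tails H W b t \<equiv> {xs. length xs = W \<and> columns_from H b t xs}"

text \<open>As long as depth \<open>H\<close> is not reached, the two ends of the next column are
  chosen independently: \<open>t' \<ge> t \<ge> b'\<close> keeps it nonempty. Columns ending below
  depth \<open>H\<close> admit no tail, hence the bound \<open>t' \<le> H\<close>.\<close>

lemma card_column_tails_step:
  assumes "\<And>b t. finite (column_tails H W b t)"
  shows "finite (column_tails H (Suc W) b t)"
    and "t < H \<Longrightarrow> card (column_tails H (Suc W) b t) =
           (\<Sum>b' = b..t. \<Sum>t' = t..H. card (column_tails H W b' t'))"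
proof -
  consider "t = H" | "t > H" | "t < H" by linarith
  then have "finite (column_tails H (Suc W) b t) \<and> (t < H \<longrightarrow> card (column_tails H (Suc W) b t) =
           (\<Sum>b' = b..t. \<Sum>t' = t..H. card (column_tails H W b' t')))"
  proof cases
    case 1
    then show ?thesis by (simp add: columns_from_full card_nested_columns)
  next
    case 2
    then have empty: "column_tails H (Suc W) b t = {}"
      using columns_from_le by fastforce
    show ?thesis unfolding empty using 2 by simp
  next
    case 3
    let ?X = "{b..t} \<times> {t..H}"
    have step: "columns_from H b t (x # xs) \<longleftrightarrow> x \<in> ?X \<and> columns_from H (fst x) (snd x) xs" for x xs
      using 3 by (cases x) (auto dest: columns_from_le)
    have fin: "finite ?X" by auto
    note C = card_Cons[where X = ?X and R = "\<lambda>x. columns_from H (fst x) (snd x)" and Q = "columns_from H b t",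
      OF fin assms step]
    then show ?thesis
      by (simp add: sum.cartesian_product case_prod_beta)
  qed
  then show "finite (column_tails H (Suc W) b t)"
    and "t < H \<Longrightarrow> card (column_tails H (Suc W) b t) =
           (\<Sum>b' = b..t. \<Sum>t' = t..H. card (column_tails H W b' t'))"
    by auto
qed

lemma finite_column_tails: "finite (column_tails H W b t)"
  by (induction W arbitrary: b t) (auto intro: card_column_tails_step(1))

text \<open>The sum telescopes by Pascal's rule in the first upper argument. It starts at
  \<open>b = Suc t\<close>, where both upper arguments equal \<open>W + (H - t)\<close> and
  antisymmetry gives 0.\<close>

lemma sum_signed_vandermonde_left:
  assumes "b \<le> Suc t" "t \<le> H"
  shows "(\<Sum>b' = b..t. signed_vandermonde W (W + (H - b')) (W + (H - t)) (2 * W)) =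
    signed_vandermonde (Suc W) (Suc (W + H) - b) (W + (H - t)) (2 * W + 1)"
  using assms(1)
proof (induction rule: inc_induct)
  case base
  then show ?case
    using signed_vandermonde_antisym[of W "W + (H - t)"] assms(2) by simp
next
  case (step b)
  have eq: "Suc (W + H) - b = Suc (W + (H - b))" "Suc (W + H) - Suc b = W + (H - b)"
    using step.hyps assms(2) by auto
  have "(\<Sum>b' = b..t. signed_vandermonde W (W + (H - b')) (W + (H - t)) (2 * W)) =
     signed_vandermonde W (W + (H - b)) (W + (H - t)) (2 * W) +
     (\<Sum>b' = Suc b..t. signed_vandermonde W (W + (H - b')) (W + (H - t)) (2 * W))"
    using step.hyps by (subst sum.atLeast_Suc_atMost) auto
  then show ?case
    using step.IH signed_vandermonde_Suc_left[of W "W + (H - b)" "W + (H - t)" "2 * W"]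
    unfolding eq by simp
qed

text \<open>This is the formula for \<open>S\<close> with \<open>h = H - b + 1\<close> and
  \<open>c = t - b + 1\<close>. The outer induction removes the first column, the inner one lowers
  \<open>t\<close> starting from \<open>H\<close>.\<close>

lemma sum_card_column_tails:
  assumes "b \<le> t" "t \<le> H"
  shows "(\<Sum>t' = t..H. int (card (column_tails H W b t'))) =
    signed_vandermonde W (W + (H - b)) (W + (H - t)) (2 * W)"
  using assms
proof (induction W arbitrary: b t)
  case 0
  have "column_tails H 0 b t' = (if t' = H then {[]} else {})" if "t' \<in> {t..H}" for t'
    using that 0 by auto
  then have "(\<Sum>t' = t..H. int (card (column_tails H 0 b t'))) = (\<Sum>t' = t..H. if t' = H then 1 else 0)"
    by (intro sum.cong) auto
  then show ?case
    using 0 by (simp add: signed_vandermonde_def)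
next
  case (Suc W)
  have card_below: "int (card (column_tails H (Suc W) b t)) =
      signed_vandermonde (Suc W) (Suc W + (H - b)) (W + (H - t)) (2 * W + 1)"
    if "b \<le> t" "t < H" for t
  proof -
    have "int (card (column_tails H (Suc W) b t)) =
        (\<Sum>b' = b..t. signed_vandermonde W (W + (H - b')) (W + (H - t)) (2 * W))"
      using that Suc.IH by (simp add: card_column_tails_step(2)[OF finite_column_tails])
    also have "\<dots> = signed_vandermonde (Suc W) (Suc (W + H) - b) (W + (H - t)) (2 * W + 1)"
      using that by (intro sum_signed_vandermonde_left) auto
    finally show ?thesis
      using that by (simp add: Suc_diff_le)
  qed
  from Suc.prems(2,1) show ?case
  proof (induction rule: inc_induct)
    case base
    \<comment> \<open>At \<open>t = H\<close> all tails are nested, and the second upper argument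
      equals the threshold \<open>Suc W\<close>, so that no negative term is left.\<close>
    have eq: "Suc W + (H - b) + Suc W = 2 * Suc W + (H - b)" by simp
    have "(\<Sum>t' = H..H. int (card (column_tails H (Suc W) b t'))) = int ((2 * Suc W + (H - b)) choose (2 * Suc W))"
      using card_nested_columns[of "Suc W" b H] base by (simp add: columns_from_full del: binomial_Suc_Suc)
    then show ?case
      using signed_vandermonde_positive[of "Suc W" "Suc W + (H - b)"]
      unfolding eq by (simp del: binomial_Suc_Suc)
  next
    case (step t)
    have eq: "Suc W + (H - t) = Suc (W + (H - t))" "Suc W + (H - Suc t) = W + (H - t)"
      using step.hyps by auto
    have "(\<Sum>t' = t..H. int (card (column_tails H (Suc W) b t'))) =
       int (card (column_tails H (Suc W) b t)) +
       (\<Sum>t' = Suc t..H. int (card (column_tails H (Suc W) b t')))"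
      using step.hyps by (subst sum.atLeast_Suc_atMost) auto
    \<comment> \<open>Pascal's rule in the second upper argument: the count for lower end exactly
      \<open>t\<close> is one summand, the sum from \<open>Suc t\<close> on is the other.\<close>
    then show ?case
      using step.IH step.prems card_below[of t] step.hyps
        signed_vandermonde_Suc_right[of "Suc W" "Suc W + (H - b)" "W + (H - t)" "2 * W + 1"]
      unfolding eq by simp
  qed
qed

text \<open>With \<open>b = t = 0\<close> the first column is only required to be nonempty. The box
  has \<open>W + 1\<close> columns and \<open>H + 1\<close> rows.\<close>

lemma sum_card_column_tails_box: "(\<Sum>t\<le>H. card (column_tails H W 0 t)) = ((W + H) choose W) ^ 2"
proof -
  have "int (\<Sum>t\<le>H. card (column_tails H W 0 t)) = int (((W + H) choose W) ^ 2)"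
    using sum_card_column_tails[of 0 0 H W] signed_vandermonde_square[of W "W + H"]
    by (simp add: atMost_atLeast0)
  then show ?thesis
    by (simp only: of_nat_eq_iff)
qed

text \<open>Positional counterpart of \<open>columns_from\<close> with no prescribed depth:
  recursion suits counting, positions suit geometry. The condition with \<open>min\<close> is
  unimodality of the lower ends.\<close>

definition column_sequence :: "(nat \<times> nat) list \<Rightarrow> bool" where
  "column_sequence xs \<longleftrightarrow>
     (\<forall>i<length xs. fst (xs ! i) \<le> snd (xs ! i)) \<and>
     (\<forall>i. Suc i < length xs \<longrightarrow> fst (xs ! i) \<le> fst (xs ! Suc i) \<and> fst (xs ! Suc i) \<le> snd (xs ! i)) \<and>
     (\<forall>i j k. i \<le> j \<longrightarrow> j \<le> k \<longrightarrow> k < length xs \<longrightarrow>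
        min (snd (xs ! i)) (snd (xs ! k)) \<le> snd (xs ! j))"

lemma column_sequence_le: "column_sequence xs \<Longrightarrow> i < length xs \<Longrightarrow> fst (xs ! i) \<le> snd (xs ! i)"
  unfolding column_sequence_def by blast

lemma column_sequence_bottom_mono:
  assumes "column_sequence xs" "i \<le> j" "j < length xs"
  shows "fst (xs ! i) \<le> fst (xs ! j)"
  using assms(2,3)
proof (induction rule: dec_induct)
  case (step n)
  have "fst (xs ! n) \<le> fst (xs ! Suc n)"
    using assms(1) step.prems unfolding column_sequence_def by blast
  with step show ?case by simp
qed simp

text \<open>Bridge from positions to recursion. Nonemptiness of the head follows from the two
  inequalities with the next column.\<close>

lemma column_sequence_Cons:
  assumes "xs \<noteq> []"
  shows "column_sequence (x # xs) \<longleftrightarrow>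
     fst x \<le> fst (hd xs) \<and> fst (hd xs) \<le> snd x \<and>
     (\<forall>j k. j \<le> k \<longrightarrow> k < length xs \<longrightarrow> min (snd x) (snd (xs ! k)) \<le> snd (xs ! j)) \<and>
     column_sequence xs" (is "?L \<longleftrightarrow> ?R")
proof
  assume L: ?L
  have "fst x \<le> fst (hd xs) \<and> fst (hd xs) \<le> snd x"
    using L assms unfolding column_sequence_def by (auto simp: hd_conv_nth dest: spec[of _ 0])
  moreover have "min (snd x) (snd (xs ! k)) \<le> snd (xs ! j)" if "j \<le> k" "k < length xs" for j k
  proof -
    have "min (snd ((x # xs) ! 0)) (snd ((x # xs) ! Suc k)) \<le> snd ((x # xs) ! Suc j)"
      using L that unfolding column_sequence_def by (metis Suc_le_mono Suc_less_eq length_Cons le0)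
    then show ?thesis by simp
  qed
  moreover have "fst (xs ! i) \<le> snd (xs ! i)" if "i < length xs" for i
  proof -
    have "fst ((x # xs) ! Suc i) \<le> snd ((x # xs) ! Suc i)"
      using L that unfolding column_sequence_def by (metis Suc_less_eq length_Cons)
    then show ?thesis by simp
  qed
  moreover have "fst (xs ! i) \<le> fst (xs ! Suc i) \<and> fst (xs ! Suc i) \<le> snd (xs ! i)"
    if "Suc i < length xs" for i
  proof -
    have "fst ((x # xs) ! Suc i) \<le> fst ((x # xs) ! Suc (Suc i)) \<and>
        fst ((x # xs) ! Suc (Suc i)) \<le> snd ((x # xs) ! Suc i)"
      using L that unfolding column_sequence_def by (metis Suc_less_eq length_Cons)
    then show ?thesis by simp
  qed
  moreover have "min (snd (xs ! i)) (snd (xs ! k)) \<le> snd (xs ! j)"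
    if "i \<le> j" "j \<le> k" "k < length xs" for i j k
  proof -
    have "min (snd ((x # xs) ! Suc i)) (snd ((x # xs) ! Suc k)) \<le> snd ((x # xs) ! Suc j)"
      using L that unfolding column_sequence_def by (metis Suc_le_mono Suc_less_eq length_Cons)
    then show ?thesis by simp
  qed
  ultimately show ?R
    unfolding column_sequence_def by blast
next
  assume R: ?R
  then have hd: "fst x \<le> fst (xs ! 0)" "fst (xs ! 0) \<le> snd x"
    and uni0: "\<And>j k. j \<le> k \<Longrightarrow> k < length xs \<Longrightarrow> min (snd x) (snd (xs ! k)) \<le> snd (xs ! j)"
    and le: "\<And>i. i < length xs \<Longrightarrow> fst (xs ! i) \<le> snd (xs ! i)"
    and step: "\<And>i. Suc i < length xs \<Longrightarrow> fst (xs ! i) \<le> fst (xs ! Suc i) \<and> fst (xs ! Suc i) \<le> snd (xs ! i)"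
    and uni: "\<And>i j k. i \<le> j \<Longrightarrow> j \<le> k \<Longrightarrow> k < length xs \<Longrightarrow> min (snd (xs ! i)) (snd (xs ! k)) \<le> snd (xs ! j)"
    using assms unfolding column_sequence_def by (simp_all add: hd_conv_nth)
  have "fst ((x # xs) ! i) \<le> snd ((x # xs) ! i)" if "i < length (x # xs)" for i
    using hd le that by (cases i) auto
  moreover have "fst ((x # xs) ! i) \<le> fst ((x # xs) ! Suc i) \<and> fst ((x # xs) ! Suc i) \<le> snd ((x # xs) ! i)"
    if "Suc i < length (x # xs)" for i
    using hd step that by (cases i) auto
  moreover have "min (snd ((x # xs) ! i)) (snd ((x # xs) ! k)) \<le> snd ((x # xs) ! j)"
    if "i \<le> j" "j \<le> k" "k < length (x # xs)" for i j k
  proof (cases j)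
    case 0
    then show ?thesis using that by simp
  next
    case (Suc j')
    with that obtain k' where k: "k = Suc k'" "j' \<le> k'" "k' < length xs"
      by (cases k) auto
    \<comment> \<open>For \<open>i = 0\<close> the fact \<open>uni0\<close> applies; otherwise
      \<open>i - 1\<close> is the position within \<open>xs\<close>.\<close>
    show ?thesis
      using uni0[of j' k'] uni[of "i - 1" j' k'] k Suc that by (cases i) simp_all
  qed
  ultimately show ?L
    unfolding column_sequence_def by blast
qed

lemma column_sequence_singleton: "column_sequence [x] \<longleftrightarrow> fst x \<le> snd x"
  unfolding column_sequence_def by auto

text \<open>Unimodal lower ends whose first value is the maximum are exactly the weakly decreasing
  ones.\<close>

lemma nested_columns_iff_column_sequence:
  "nested_columns b t xs \<longleftrightarrow> column_sequence ((b, t) # xs) \<and> (\<forall>y\<in>set xs. snd y \<le> t)"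
proof (induction b t xs rule: nested_columns.induct)
  case (1 b t)
  then show ?case by (simp add: column_sequence_singleton)
next
  case (2 b t b' t' xs)
  let ?ys = "(b', t') # xs"
  have "nested_columns b t ?ys \<longleftrightarrow> b \<le> b' \<and> t' \<le> t \<and> column_sequence ?ys \<and> (\<forall>y\<in>set ?ys. snd y \<le> t')"
    unfolding nested_columns.simps 2 by simp
  also have "\<dots> \<longleftrightarrow> column_sequence ((b, t) # ?ys) \<and> (\<forall>y\<in>set ?ys. snd y \<le> t)" (is "?L \<longleftrightarrow> ?R")
  proof
    assume L: ?L
    have "b' \<le> t'"
      using L column_sequence_le[of ?ys 0] by simp
    moreover have "min t (snd (?ys ! k)) \<le> snd (?ys ! j)" if "j \<le> k" "k < length ?ys" for j k
    proof -
      have "min (snd (?ys ! 0)) (snd (?ys ! k)) \<le> snd (?ys ! j)"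
        using L that unfolding column_sequence_def by blast
      moreover have "snd (?ys ! k) \<le> t'"
        using L nth_mem[OF that(2)] by blast
      ultimately show ?thesis by simp
    qed
    moreover have "b \<le> b'" "t' \<le> t" "column_sequence ?ys" "\<forall>y\<in>set ?ys. snd y \<le> t'"
      using L by auto
    moreover have "\<forall>y\<in>set ?ys. snd y \<le> t"
      using L by (meson le_trans)
    ultimately show ?R
      using column_sequence_Cons[of ?ys "(b, t)"] by simp
  next
    assume R: ?R
    then have C: "b \<le> b'" "column_sequence ?ys"
      and uni: "\<And>j k. j \<le> k \<Longrightarrow> k < length ?ys \<Longrightarrow> min t (snd (?ys ! k)) \<le> snd (?ys ! j)"
      using column_sequence_Cons[of ?ys "(b, t)"] by simp_all
    have "snd y \<le> t'" if "y \<in> set ?ys" for y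
    proof -
      from that obtain k where k: "k < length ?ys" "?ys ! k = y"
        unfolding in_set_conv_nth by blast
      \<comment> \<open>Unimodality is applied to the head, its successor and
        \<open>y\<close>.\<close>
      have "min t (snd y) \<le> t'"
        using uni[of 0 k, unfolded k(2)] k(1) by simp
      moreover have "snd y \<le> t"
        using R that by blast
      ultimately show ?thesis
        by (simp only: min_absorb2)
    qed
    with C R show ?L by simp
  qed
  finally show ?case .
qed

text \<open>While the maximum \<open>H\<close> still lies ahead, unimodality forces the lower ends
  to increase; once it is attained, the nested case takes over.\<close>

lemma columns_from_iff_column_sequence:
  "columns_from H b t xs \<longleftrightarrow> column_sequence ((b, t) # xs) \<and>
     (\<forall>y\<in>set ((b, t) # xs). snd y \<le> H) \<and> H \<in> snd ` set ((b, t) # xs)"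
proof (induction xs arbitrary: b t)
  case Nil
  then show ?case by (auto simp: column_sequence_singleton)
next
  case (Cons x xs)
  obtain b' t' where x: "x = (b', t')" by fastforce
  let ?ys = "(b', t') # xs"
  show ?case
  proof (cases "t = H")
    case True
    then show ?thesis
      unfolding x True columns_from_full nested_columns_iff_column_sequence by simp
  next
    case False
    have "columns_from H b t ?ys \<longleftrightarrow> b \<le> b' \<and> b' \<le> t \<and> t \<le> t' \<and> column_sequence ?ys \<and>
        (\<forall>y\<in>set ?ys. snd y \<le> H) \<and> H \<in> snd ` set ?ys"
      using False Cons.IH[of b' t'] by simp
    also have "\<dots> \<longleftrightarrow> column_sequence ((b, t) # ?ys) \<and>
        (\<forall>y\<in>set ((b, t) # ?ys). snd y \<le> H) \<and> H \<in> snd ` set ((b, t) # ?ys)" (is "?L \<longleftrightarrow> ?R")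
    proof
      assume L: ?L
      have "min t (snd (?ys ! k)) \<le> snd (?ys ! j)" if "j \<le> k" "k < length ?ys" for j k
      proof -
        have "min (snd (?ys ! 0)) (snd (?ys ! k)) \<le> snd (?ys ! j)"
          using L that unfolding column_sequence_def by blast
        moreover have "t \<le> t'" using L by blast
        ultimately show ?thesis by simp
      qed
      moreover have "t \<le> H"
        using L by simp
      ultimately show ?R
        using L column_sequence_Cons[of ?ys "(b, t)"] by simp
    next
      assume R: ?R
      then have C: "b \<le> b'" "b' \<le> t" "column_sequence ?ys"
        and uni: "\<And>j k. j \<le> k \<Longrightarrow> k < length ?ys \<Longrightarrow> min t (snd (?ys ! k)) \<le> snd (?ys ! j)"
        using column_sequence_Cons[of ?ys "(b, t)"] by simp_all
      from R False have H: "H \<in> snd ` set ?ys" "t \<le> H" by auto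
      \<comment> \<open>A later column attains \<open>H\<close>; the successor of the head lies
        between the two, so its lower end is at least \<open>min t H = t\<close>.\<close>
      then obtain k where "k < length ?ys" "snd (?ys ! k) = H"
        by (metis (no_types, lifting) imageE in_set_conv_nth)
      with uni[of 0 k] H have "t \<le> t'" by simp
      with C R False show ?L by simp
    qed
    finally show ?thesis unfolding x .
  qed
qed

subsection \<open>From column sequences to polyominoes\<close>

text \<open>Columns are listed from right to left and intervals are depths, so that \<open>(0, 0)\<close> is the
  north-east corner of the bounding box.\<close>

definition column_cells :: "(nat \<times> nat) list \<Rightarrow> cell set" where
  "column_cells xs =
     (\<lambda>(i, z). (- int i, - int z)) ` (SIGMA i:{..<length xs}. {fst (xs ! i)..snd (xs ! i)})"

lemma mem_column_cells:
  "(x, y) \<in> column_cells xs \<longleftrightarrow> x \<le> 0 \<and> y \<le> 0 \<and> nat (- x) < length xs \<and>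
     fst (xs ! nat (- x)) \<le> nat (- y) \<and> nat (- y) \<le> snd (xs ! nat (- x))" (is "?L \<longleftrightarrow> ?R")
proof
  show "?L \<Longrightarrow> ?R" by (auto simp: column_cells_def)
  assume ?R
  then have "(\<lambda>(i, z). (- int i, - int z)) (nat (- x), nat (- y)) \<in> column_cells xs"
    unfolding column_cells_def by (intro imageI) simp
  with \<open>?R\<close> show ?L by simp
qed

lemma mem_column_cells_int:
  "(- int i, - int z) \<in> column_cells xs \<longleftrightarrow> i < length xs \<and> fst (xs ! i) \<le> z \<and> z \<le> snd (xs ! i)"
  by (simp add: mem_column_cells)

lemma finite_column_cells: "finite (column_cells xs)"
  unfolding column_cells_def by (intro finite_imageI finite_SigmaI) auto

section \<open>Convexity and connectedness\<close>

lemma int_interval: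
  fixes A :: "int set"
  assumes "finite A" "\<And>a b c. a \<in> A \<Longrightarrow> c \<in> A \<Longrightarrow> a \<le> b \<Longrightarrow> b \<le> c \<Longrightarrow> b \<in> A"
  shows "\<exists>l r. A = {l..r}"
proof (cases "A = {}")
  case True
  then have "A = {1..0}" by simp
  then show ?thesis by blast
next
  case False
  have "A = {Min A..Max A}"
  proof (intro equalityI subsetI)
    fix b assume "b \<in> {Min A..Max A}"
    then show "b \<in> A"
      using assms(2)[OF Min_in[OF assms(1) False] Max_in[OF assms(1) False]] by simp
  next
    show "b \<in> {Min A..Max A}" if "b \<in> A" for b
      using assms(1) that by simp
  qed
  then show ?thesis by blast
qed

text \<open>The upper end in the middle is bounded by the one further west by monotonicity, the
  lower end by the smaller of the two outer ones by unimodality. Indices count westwards, so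
  \<open>x3\<close> has the smallest.\<close>

lemma column_cells_row:
  assumes "column_sequence xs" "(x1, y) \<in> column_cells xs" "(x3, y) \<in> column_cells xs"
    "x1 \<le> x2" "x2 \<le> x3"
  shows "(x2, y) \<in> column_cells xs"
proof -
  let ?i = "nat (- x3)" and ?j = "nat (- x2)" and ?k = "nat (- x1)" and ?z = "nat (- y)"
  have *: "?i \<le> ?j" "?j \<le> ?k" "?k < length xs" "x2 \<le> 0" "y \<le> 0" "fst (xs ! ?k) \<le> ?z"
      "?z \<le> snd (xs ! ?i)" "?z \<le> snd (xs ! ?k)"
    using assms by (auto simp: mem_column_cells)
  then have "fst (xs ! ?j) \<le> ?z"
    using column_sequence_bottom_mono[OF assms(1) *(2,3)] by simp
  moreover have "min (snd (xs ! ?i)) (snd (xs ! ?k)) \<le> snd (xs ! ?j)"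
    using assms(1) * unfolding column_sequence_def by blast
  moreover have "?z \<le> min (snd (xs ! ?i)) (snd (xs ! ?k))"
    using * by simp
  ultimately show ?thesis
    using * unfolding mem_column_cells by linarith
qed

lemma column_cells_column:
  assumes "(x, y1) \<in> column_cells xs" "(x, y3) \<in> column_cells xs" "y1 \<le> y2" "y2 \<le> y3"
  shows "(x, y2) \<in> column_cells xs"
proof -
  have "nat (- y3) \<le> nat (- y2)" "nat (- y2) \<le> nat (- y1)"
    using assms(3,4) by auto
  then show ?thesis
    using assms by (auto simp: mem_column_cells)
qed

lemma edge_adjacent_sym: "edge_adjacent a b \<longleftrightarrow> edge_adjacent b a"
  by (auto simp: edge_adjacent_def)

text \<open>Adjacency is symmetric, so two paths to the common root \<open>c\<close> join into
  one.\<close>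

lemma edge_connected_root:
  assumes "\<And>a. a \<in> P \<Longrightarrow> (a, c) \<in> {(u, v). u \<in> P \<and> v \<in> P \<and> edge_adjacent u v}\<^sup>*"
  shows "edge_connected P"
proof -
  let ?E = "{(u, v). u \<in> P \<and> v \<in> P \<and> edge_adjacent u v}"
  have "?E\<inverse> = ?E"
    using edge_adjacent_sym by auto
  then have "(c, b) \<in> ?E\<^sup>*" if "b \<in> P" for b
    using rtrancl_converseI[OF assms[OF that]] by simp
  then show ?thesis
    unfolding edge_connected_def using assms by (meson rtrancl_trans)
qed

text \<open>From any cell one reaches the corner by going north while possible and east otherwise.\<close>

lemma edge_connected_column_cells:
  assumes "column_sequence xs" "fst (xs ! 0) = 0"
  shows "edge_connected (column_cells xs)"
proof (rule edge_connected_root)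
  let ?E = "{(u, v). u \<in> column_cells xs \<and> v \<in> column_cells xs \<and> edge_adjacent u v}"
  have *: "(- int i, - int z) \<in> column_cells xs \<Longrightarrow> ((- int i, - int z), (0, 0)) \<in> ?E\<^sup>*" for i z
  proof (induction "i + z" arbitrary: i z)
    case 0
    then show ?case by simp
  next
    case (Suc m)
    have cell: "i < length xs" "fst (xs ! i) \<le> z" "z \<le> snd (xs ! i)"
      using Suc.prems by (simp_all only: mem_column_cells_int)
    show ?case
    proof (cases "fst (xs ! i) = z")
      case True
      \<comment> \<open>At the top of column 0 the cell would be the corner itself, contradicting
        \<open>i + z = Suc m\<close>. In any other column the overlap condition supplies the eastern
        neighbour.\<close>
      have "i \<noteq> 0"
      proof
        assume "i = 0"
        then show False
          using Suc.hyps(2) assms(2) True by simp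
      qed
      then obtain j where j: "i = Suc j"
        using not0_implies_Suc by blast
      have "fst (xs ! j) \<le> z" "z \<le> snd (xs ! j)"
        using assms(1) cell(1) True unfolding column_sequence_def j by auto
      then have mem: "(- int j, - int z) \<in> column_cells xs"
        using cell(1) unfolding j mem_column_cells_int by simp
      then have "((- int j, - int z), (0, 0)) \<in> ?E\<^sup>*"
        using Suc.hyps j by simp
      moreover have "((- int i, - int z), (- int j, - int z)) \<in> ?E"
        using Suc.prems mem by (simp add: edge_adjacent_def j)
      ultimately show ?thesis
        by (rule converse_rtrancl_into_rtrancl[rotated])
    next
      case False
      then obtain y where y: "z = Suc y" "fst (xs ! i) \<le> y"
        using cell(2) by (metis Suc_le_mono le_neq_implies_less less_eq_Suc_le old.nat.exhaust not_less0)
      then have mem: "(- int i, - int y) \<in> column_cells xs"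
        using cell unfolding mem_column_cells_int by simp
      then have "((- int i, - int y), (0, 0)) \<in> ?E\<^sup>*"
        using Suc.hyps y by simp
      moreover have "((- int i, - int z), (- int i, - int y)) \<in> ?E"
        using Suc.prems mem by (simp add: edge_adjacent_def y)
      ultimately show ?thesis
        by (rule converse_rtrancl_into_rtrancl[rotated])
    qed
  qed
  show "(a, (0, 0)) \<in> ?E\<^sup>*" if "a \<in> column_cells xs" for a
    using that *[of "nat (- fst a)" "nat (- snd a)"] by (cases a) (auto simp: mem_column_cells)
qed

lemma origin_in_column_cells:
  "xs \<noteq> [] \<Longrightarrow> fst (xs ! 0) = 0 \<Longrightarrow> (0, 0) \<in> column_cells xs"
  by (simp add: mem_column_cells)

lemma convex_column_cells:
  assumes "column_sequence xs" "xs \<noteq> []" "fst (xs ! 0) = 0"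
  shows "convex_polyomino (column_cells xs)"
proof -
  have "\<exists>l r. {x. (x, y) \<in> column_cells xs} = {l..r}" for y
  proof (rule int_interval)
    show "finite {x. (x, y) \<in> column_cells xs}"
      by (rule finite_subset[OF _ finite_imageI[OF finite_column_cells, of fst xs]]) force
    show "b \<in> {x. (x, y) \<in> column_cells xs}"
      if "a \<in> {x. (x, y) \<in> column_cells xs}" "c \<in> {x. (x, y) \<in> column_cells xs}" "a \<le> b" "b \<le> c" for a b c
      using column_cells_row[OF assms(1), of a y c b] that by simp
  qed
  moreover have "\<exists>l r. {y. (x, y) \<in> column_cells xs} = {l..r}" for x
  proof (rule int_interval)
    show "finite {y. (x, y) \<in> column_cells xs}"
      by (rule finite_subset[OF _ finite_imageI[OF finite_column_cells, of snd xs]]) force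
    show "b \<in> {y. (x, y) \<in> column_cells xs}"
      if "a \<in> {y. (x, y) \<in> column_cells xs}" "c \<in> {y. (x, y) \<in> column_cells xs}" "a \<le> b" "b \<le> c" for a b c
      using column_cells_column[of x a xs c b] that by simp
  qed
  moreover have "column_cells xs \<noteq> {}"
    using origin_in_column_cells[OF assms(2,3)] by blast
  ultimately show ?thesis
    using finite_column_cells edge_connected_column_cells[OF assms(1,3)]
    unfolding convex_polyomino_def polyomino_def by blast
qed

lemma column_cells_Max:
  assumes "xs \<noteq> []" "fst (xs ! 0) = 0"
  shows "Max (fst ` column_cells xs) = 0" "Max (snd ` column_cells xs) = 0"
proof -
  have "0 \<in> fst ` column_cells xs" "0 \<in> snd ` column_cells xs"
    using origin_in_column_cells[OF assms] by force+
  then show "Max (fst ` column_cells xs) = 0" "Max (snd ` column_cells xs) = 0"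
    by (auto intro!: Max_eqI finite_imageI finite_column_cells simp: mem_column_cells)
qed

text \<open>Depths range from 0 to \<open>H\<close>, which accounts for \<open>Suc H\<close>
  rows.\<close>

lemma semi_perimeter_column_cells:
  assumes "column_sequence xs" "xs \<noteq> []" "fst (xs ! 0) = 0"
    "\<forall>y\<in>set xs. snd y \<le> H" "H \<in> snd ` set xs"
  shows "semi_perimeter (column_cells xs) = length xs + Suc H"
proof -
  let ?n = "length xs - 1"
  have "(- int ?n, - int (fst (xs ! ?n))) \<in> column_cells xs"
    using assms(2) column_sequence_le[OF assms(1), of ?n] unfolding mem_column_cells_int by simp
  then have "- int ?n \<in> fst ` column_cells xs"
    by (rule rev_image_eqI) simp
  moreover have "- int ?n \<le> x" if "x \<in> fst ` column_cells xs" for x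
  proof -
    from that obtain y where "(x, y) \<in> column_cells xs" by auto
    then have "x \<le> 0" "nat (- x) < length xs"
      by (auto simp: mem_column_cells)
    then show ?thesis by linarith
  qed
  ultimately have "Min (fst ` column_cells xs) = - int ?n"
    by (intro Min_eqI finite_imageI finite_column_cells)
  then have "width (column_cells xs) = length xs"
    using assms(2) column_cells_Max[OF assms(2,3)] unfolding width_def by (cases xs) auto
  moreover have "Min (snd ` column_cells xs) = - int H"
  proof (intro Min_eqI finite_imageI finite_column_cells)
    obtain i where i: "i < length xs" "snd (xs ! i) = H"
      using assms(5) by (metis imageE in_set_conv_nth)
    then have "(- int i, - int H) \<in> column_cells xs"
      using column_sequence_le[OF assms(1) i(1)] unfolding mem_column_cells_int by simp
    then show "- int H \<in> snd ` column_cells xs" by force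
    show "- int H \<le> y" if "y \<in> snd ` column_cells xs" for y
    proof -
      from that obtain x where x: "(x, y) \<in> column_cells xs" by auto
      then have "nat (- y) \<le> snd (xs ! nat (- x))" "nat (- x) < length xs"
        by (auto simp: mem_column_cells)
      moreover from this have "snd (xs ! nat (- x)) \<le> H"
        using assms(4) by (meson nth_mem)
      ultimately show ?thesis by simp
    qed
  qed
  then have "height (column_cells xs) = Suc H"
    using column_cells_Max[OF assms(2,3)] by (simp add: height_def)
  ultimately show ?thesis by (simp add: semi_perimeter_def)
qed

section \<open>North-west paths and direction changes\<close>

lemma nw_path_le:
  assumes "nw_path P a b p"
  shows "a \<in> P" "b \<in> P" "fst b \<le> fst a" "snd a \<le> snd b"
proof -
  have p: "p \<noteq> []" "hd p = a" "last p = b" "set p \<subseteq> P"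
    and s: "successively (\<lambda>u v. north_step u v \<or> west_step u v) p"
    using assms by (auto simp: nw_path_def)
  show "a \<in> P" "b \<in> P"
    using p by auto
  from p(1) s have "fst (last p) \<le> fst (hd p) \<and> snd (hd p) \<le> snd (last p)"
  proof (induction p rule: induct_list012)
    case 1
    then show ?case by simp
  next
    case (2 u)
    show ?case by simp
  next
    case (3 u v p)
    then have "fst v \<le> fst u" "snd u \<le> snd v"
      by (auto simp: north_step_def west_step_def)
    moreover have "fst (last (v # p)) \<le> fst v \<and> snd v \<le> snd (last (v # p))"
      using 3 by simp
    ultimately show ?case by simp
  qed
  then show "fst b \<le> fst a" "snd a \<le> snd b"
    using p by auto
qed

text \<open>The path makes \<open>A\<close> steps north and then \<open>B\<close> steps west, so it
  turns at most once.\<close>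

lemma L_path:
  fixes x y :: int
  assumes "\<And>k. k \<le> A \<Longrightarrow> (x, y + int k) \<in> P" "\<And>k. k \<le> B \<Longrightarrow> (x - int k, y + int A) \<in> P"
  shows "\<exists>p. nw_path P (x, y) (x - int B, y + int A) p \<and> direction_changes p \<le> 1"
proof -
  define f where "f k = (if k \<le> A then (x, y + int k) else (x - int (k - A), y + int A))" for k
  define p where "p = map f [0..<Suc (A + B)]"
  have len: "length p = Suc (A + B)" by (simp add: p_def)
  have nth: "p ! k = f k" if "k \<le> A + B" for k
    using that unfolding p_def by (subst nth_map) (auto simp del: upt_Suc)
  have north: "north_step (f k) (f (Suc k)) \<longleftrightarrow> k < A" for k
    by (auto simp: north_step_def f_def Suc_diff_le)
  have west: "west_step (f k) (f (Suc k))" if "\<not> k < A" for k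
    using that by (auto simp: west_step_def f_def Suc_diff_le)
  have "nw_path P (x, y) (x - int B, y + int A) p"
    unfolding nw_path_def
  proof (intro conjI)
    show "p \<noteq> []" using len by auto
    then show "hd p = (x, y)" "last p = (x - int B, y + int A)"
      by (auto simp: hd_conv_nth last_conv_nth len nth f_def)
    have "f k \<in> P" if "k \<le> A + B" for k
      using assms(1)[of k] assms(2)[of "k - A"] that by (auto simp: f_def simp del: of_nat_diff)
    then show "set p \<subseteq> P"
      unfolding p_def by auto
    show "successively (\<lambda>u v. north_step u v \<or> west_step u v) p"
      using north west by (auto simp: successively_conv_nth len nth)
  qed
  \<comment> \<open>A change is indexed by the first of its three cells, so the turn at position
    \<open>A\<close> has index \<open>A - 1\<close>.\<close>
  moreover have "{i. i + 2 < length p \<and>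
       north_step (p ! i) (p ! (i + 1)) \<noteq> north_step (p ! (i + 1)) (p ! (i + 2))} \<subseteq> {A - 1}"
  proof
    fix i assume "i \<in> {i. i + 2 < length p \<and>
       north_step (p ! i) (p ! (i + 1)) \<noteq> north_step (p ! (i + 1)) (p ! (i + 2))}"
    then have "i + 2 \<le> A + B" "north_step (p ! i) (p ! Suc i) \<noteq> north_step (p ! Suc i) (p ! Suc (Suc i))"
      by (simp_all add: len)
    then have "(i < A) \<noteq> (Suc i < A)"
      using north[of i] north[of "Suc i"] nth[of i] nth[of "Suc i"] nth[of "Suc (Suc i)"] by simp
    then show "i \<in> {A - 1}" by auto
  qed
  then have "direction_changes p \<le> 1"
    unfolding direction_changes_def by (rule order_trans[OF card_mono[rotated]]) simp_all
  ultimately show ?thesis by blast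
qed

text \<open>Let \<open>b\<close> be reachable from \<open>a\<close>. The column of \<open>b\<close>
  lies to the west, so its upper end is at least as deep as that of the column of \<open>a\<close>.
  Hence the latter column extends up to the row of \<open>b\<close>, and the L-shaped path through
  \<open>(x, y')\<close> stays inside.\<close>

lemma D_NW_column_cells:
  assumes "column_sequence xs" "xs \<noteq> []" "fst (xs ! 0) = 0"
  shows "D_NW (column_cells xs) \<le> 1"
proof -
  let ?P = "column_cells xs"
  have "D_NW_cells ?P a b \<le> 1" if "nw_reachable ?P a b" for a b
  proof -
    from that obtain p where p: "nw_path ?P a b p"
      unfolding nw_reachable_def by blast
    obtain x y x' y' where ab: "a = (x, y)" "b = (x', y')" by fastforce
    note p = nw_path_le[OF p, unfolded ab fst_conv snd_conv]
    have "fst (xs ! nat (- x)) \<le> fst (xs ! nat (- x'))"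
      using p by (intro column_sequence_bottom_mono[OF assms(1)]) (auto simp: mem_column_cells)
    moreover have "nat (- y') \<le> nat (- y)"
      using p by simp
    ultimately have corner: "(x, y') \<in> ?P"
      using p unfolding mem_column_cells by linarith
    have target: "x - int (nat (x - x')) = x'" "y + int (nat (y' - y)) = y'"
      using p by simp_all
    have "\<exists>q. nw_path ?P (x, y) (x - int (nat (x - x')), y + int (nat (y' - y))) q \<and> direction_changes q \<le> 1"
    proof (rule L_path)
      show "(x, y + int k) \<in> ?P" if "k \<le> nat (y' - y)" for k
        using that p(4) by (intro column_cells_column[OF p(1) corner]) linarith+
      show "(x - int k, y + int (nat (y' - y))) \<in> ?P" if "k \<le> nat (x - x')" for k
        unfolding target using that p(3) by (intro column_cells_row[OF assms(1) p(2) corner]) linarith+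
    qed
    then obtain q where q: "nw_path ?P a b q" "direction_changes q \<le> 1"
      unfolding target ab by blast
    have "D_NW_cells ?P a b \<le> direction_changes q"
      unfolding D_NW_cells_def using q(1) by (intro Least_le) blast
    with q(2) show ?thesis by simp
  qed
  \<comment> \<open>Bounding \<open>Max\<close> requires a finite nonempty set: its indices are
    pairs of cells, and the origin reaches itself.\<close>
  moreover have "{D_NW_cells ?P a b | a b. nw_reachable ?P a b} \<subseteq>
      (\<lambda>(a, b). D_NW_cells ?P a b) ` (?P \<times> ?P)"
  proof
    fix k assume "k \<in> {D_NW_cells ?P a b | a b. nw_reachable ?P a b}"
    then obtain a b where k: "k = D_NW_cells ?P a b" and "nw_reachable ?P a b"
      by blast
    then obtain p where "nw_path ?P a b p"
      unfolding nw_reachable_def by blast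
    then have "(a, b) \<in> ?P \<times> ?P"
      using nw_path_le(1,2) by simp
    then show "k \<in> (\<lambda>(a, b). D_NW_cells ?P a b) ` (?P \<times> ?P)"
      unfolding k by (rule rev_image_eqI) simp
  qed
  then have "finite {D_NW_cells ?P a b | a b. nw_reachable ?P a b}"
    by (rule finite_subset) (intro finite_imageI finite_cartesian_product finite_column_cells)
  moreover have "nw_reachable ?P (0, 0) (0, 0)"
    using origin_in_column_cells[OF assms(2,3)]
    unfolding nw_reachable_def nw_path_def by (intro exI[of _ "[(0, 0)]"]) simp
  then have "{D_NW_cells ?P a b | a b. nw_reachable ?P a b} \<noteq> {}" by blast
  ultimately show ?thesis
    unfolding D_NW_def by (subst Max_le_iff) auto
qed

lemma rectangular_ascending_column_cells:
  assumes "column_sequence xs" "xs \<noteq> []" "fst (xs ! 0) = 0"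
  shows "rectangular_ascending (column_cells xs)"
proof -
  have "Max {y. (0, y) \<in> column_cells xs} = 0"
  proof (rule Max_eqI)
    show "finite {y. (0, y) \<in> column_cells xs}"
      by (rule finite_subset[OF _ finite_imageI[OF finite_column_cells, of snd xs]]) force
    show "y \<le> 0" if "y \<in> {y. (0, y) \<in> column_cells xs}" for y
      using that by (simp add: mem_column_cells)
    show "0 \<in> {y. (0, y) \<in> column_cells xs}"
      using origin_in_column_cells[OF assms(2,3)] by simp
  qed
  then show ?thesis
    using convex_column_cells[OF assms] D_NW_column_cells[OF assms]
    by (simp add: rectangular_ascending_def ascending_def rightmost_column_top_def
        column_cells_Max[OF assms(2,3)])
qed

text \<open>Columns are nonempty, so their number and their ends can be read off from the
  cells.\<close>

lemma column_cells_inj: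
  assumes "column_sequence xs" "column_sequence ys" "column_cells xs = column_cells ys"
  shows "xs = ys"
proof -
  have eq: "i < length xs \<and> fst (xs ! i) \<le> z \<and> z \<le> snd (xs ! i) \<longleftrightarrow>
      i < length ys \<and> fst (ys ! i) \<le> z \<and> z \<le> snd (ys ! i)" for i z
    using assms(3) by (simp flip: mem_column_cells_int)
  have iff: "i < length xs \<longleftrightarrow> i < length ys" for i
    using eq[of i "fst (xs ! i)"] eq[of i "fst (ys ! i)"]
      column_sequence_le[OF assms(1)] column_sequence_le[OF assms(2)] by auto
  show ?thesis
  proof (rule nth_equalityI)
    show "length xs = length ys"
      using iff by (meson linorder_neqE_nat less_irrefl)
    fix i assume i: "i < length xs"
    note le = column_sequence_le[OF assms(1) i] column_sequence_le[OF assms(2) iffD1[OF iff i]]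
    show "xs ! i = ys ! i"
      using eq[of i "fst (xs ! i)"] eq[of i "snd (xs ! i)"] eq[of i "fst (ys ! i)"]
        eq[of i "snd (ys ! i)"] le i iff[of i] by (intro prod_eqI) auto
  qed
qed

subsection \<open>The generating function of the central binomial coefficients\<close>

text \<open>Both sides satisfy \<open>(n + 1) * u (n + 1) = 2 * (2 * n + 1) * u n\<close>.\<close>

lemma central_binomial_gbinomial:
  "real ((2 * n) choose n) = (- 4) ^ n * ((- 1 / 2) gchoose n)"
proof (induction n)
  case (Suc n)
  have "Suc n * ((2 * Suc n) choose Suc n) = 2 * (2 * n + 1) * ((2 * n) choose n)"
  proof -
    have "Suc n * (Suc n * ((2 * Suc n) choose Suc n)) = Suc n * (2 * Suc n * ((2 * n + 1) choose n))"
      using Suc_times_binomial[of n "2 * n + 1"] by (simp del: binomial_Suc_Suc)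
    also have "(2 * n + 1) choose n = (2 * n + 1) choose Suc n"
      by (subst binomial_symmetric) auto
    also have "Suc n * (2 * Suc n * ((2 * n + 1) choose Suc n)) =
        2 * Suc n * (Suc n * (Suc (2 * n) choose Suc n))"
      by (simp add: algebra_simps del: binomial_Suc_Suc)
    also have "Suc n * (Suc (2 * n) choose Suc n) = Suc (2 * n) * ((2 * n) choose n)"
      by (rule Suc_times_binomial)
    finally have "Suc n * (Suc n * ((2 * Suc n) choose Suc n)) =
        Suc n * (2 * (2 * n + 1) * ((2 * n) choose n))"
      by (simp add: algebra_simps del: binomial_Suc_Suc)
    then show ?thesis by (simp only: mult_left_cancel) 
  qed
  then have "real (Suc n * ((2 * Suc n) choose Suc n)) = real (2 * (2 * n + 1) * ((2 * n) choose n))"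
    by (simp only:)
  then have "real (Suc n) * real ((2 * Suc n) choose Suc n) =
      2 * (2 * real n + 1) * real ((2 * n) choose n)"
    by (simp only: of_nat_mult) simp
  also have "\<dots> = real (Suc n) * ((- 4) ^ Suc n * ((- 1 / 2) gchoose Suc n))"
  proof -
    have "real (Suc n) * ((- 1 / 2) gchoose Suc n) = (- 1 / 2 - real n) * ((- 1 / 2 :: real) gchoose n)"
      using gbinomial_mult_1[of "- 1 / 2 :: real" n] by (simp only: left_diff_distrib)
    moreover have "real (Suc n) * ((- 4) ^ Suc n * ((- 1 / 2 :: real) gchoose Suc n)) =
        (- 4) ^ Suc n * (real (Suc n) * ((- 1 / 2) gchoose Suc n))"
      by (rule mult.left_commute)
    moreover have "2 * (2 * real n + 1) * ((- 4) ^ n * g) = (- 4) ^ Suc n * ((- 1 / 2 - real n) * g)" for g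
      by (simp add: algebra_simps)
    ultimately show ?thesis
      unfolding Suc.IH by (simp only:)
  qed
  finally show ?case
    by (simp only: mult_cancel_left of_nat_eq_0_iff) simp
qed simp

text \<open>The series is the binomial series with exponent \<open>- 1 / 2\<close> at
  \<open>- 4 * fps_X\<close>. The exponents \<open>- 1 / 2\<close>, \<open>- 1 / 2\<close> and
  \<open>1\<close> add up to 0.\<close>

lemma central_binomial_fps_square:
  "Abs_fps (\<lambda>n. real ((2 * n) choose n)) ^ 2 * (1 - 4 * fps_X) = 1"
proof -
  let ?c = "fps_const (- 4 :: real) * fps_X"
  have c: "1 - 4 * fps_X = 1 + ?c"
    by (simp add: fps_eq_iff numeral_fps_const)
  have "Abs_fps (\<lambda>n. real ((2 * n) choose n)) = fps_binomial (- 1 / 2) oo ?c"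
    by (simp add: fps_compose_linear central_binomial_gbinomial)
  then have "Abs_fps (\<lambda>n. real ((2 * n) choose n)) ^ 2 * (1 - 4 * fps_X) =
      (fps_binomial (- 1 / 2) * fps_binomial (- 1 / 2) * fps_binomial 1) oo ?c"
    unfolding c by (simp add: fps_compose_mult_distrib power2_eq_square fps_binomial_1
        fps_compose_add_distrib)
  also have "\<dots> = 1"
    by (simp flip: fps_binomial_add_mult)
  finally show ?thesis .
qed

lemma central_binomial_fps:
  "Abs_fps (\<lambda>n. real ((2 * n) choose n)) * fps_radical root 2 (1 - 4 * fps_X) = 1"
proof -
  let ?F = "Abs_fps (\<lambda>n. real ((2 * n) choose n))" and ?R = "fps_radical root 2 (1 - 4 * fps_X :: real fps)"
  have "?R ^ 2 = 1 - 4 * fps_X"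
    using power_radical[of "1 - 4 * fps_X :: real fps" root 1] by (simp add: numeral_2_eq_2)
  then have "(?F * ?R) ^ 2 = 1"
    using central_binomial_fps_square by (simp add: power_mult_distrib)
  then have "?F * ?R = 1 \<or> ?F * ?R = - 1"
    by (simp add: power2_eq_1_iff)
  \<comment> \<open>The constant coefficient decides the sign of the square root.\<close>
  moreover have "fps_nth (?F * ?R) 0 = (1::real)"
    by (simp add: numeral_2_eq_2)
  ultimately show ?thesis
    by fastforce
qed

subsection \<open>From polyominoes to column sequences\<close>

text \<open>Connectedness as an induction principle: walking from \<open>c\<close> inside
  \<open>P\<close> never leaves \<open>A\<close>.\<close>

lemma edge_connected_cut:
  assumes "edge_connected P" "c \<in> P" "c \<in> A"
    and "\<And>a b. a \<in> A \<Longrightarrow> a \<in> P \<Longrightarrow> b \<in> P \<Longrightarrow> edge_adjacent a b \<Longrightarrow> b \<in> A"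
  shows "P \<subseteq> A"
proof
  fix b assume "b \<in> P"
  then have "(c, b) \<in> {(u, v). u \<in> P \<and> v \<in> P \<and> edge_adjacent u v}\<^sup>*"
    using assms(1,2) unfolding edge_connected_def by blast
  then show "b \<in> A"
    using assms(3,4) by (induction rule: rtrancl_induct) auto
qed

text \<open>\<open>Q i z\<close> says that the cell at distance \<open>i\<close> west and \<open>z\<close> south of the corner is present;
  \<open>cut\<close> is connectedness in the form of an induction principle.\<close>

lemma ex_column_sequence:
  fixes Q :: "nat \<Rightarrow> nat \<Rightarrow> bool"
  assumes origin: "Q 0 0"
    and fin: "finite {(i, z). Q i z}"
    and col: "\<And>i z1 z2 z3. Q i z1 \<Longrightarrow> Q i z3 \<Longrightarrow> z1 \<le> z2 \<Longrightarrow> z2 \<le> z3 \<Longrightarrow> Q i z2"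
    and row: "\<And>i1 i2 i3 z. Q i1 z \<Longrightarrow> Q i3 z \<Longrightarrow> i1 \<le> i2 \<Longrightarrow> i2 \<le> i3 \<Longrightarrow> Q i2 z"
    and cut: "\<And>R i z. R 0 0 \<Longrightarrow>
       (\<And>i z. R i z \<Longrightarrow> Q i z \<Longrightarrow> Q (Suc i) z \<Longrightarrow> R (Suc i) z) \<Longrightarrow>
       (\<And>i z. R (Suc i) z \<Longrightarrow> Q (Suc i) z \<Longrightarrow> Q i z \<Longrightarrow> R i z) \<Longrightarrow>
       (\<And>i z. R i z \<Longrightarrow> Q i z \<Longrightarrow> Q i (Suc z) \<Longrightarrow> R i (Suc z)) \<Longrightarrow>
       (\<And>i z. R i (Suc z) \<Longrightarrow> Q i (Suc z) \<Longrightarrow> Q i z \<Longrightarrow> R i z) \<Longrightarrow>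
       Q i z \<Longrightarrow> R i z"
  shows "\<exists>xs. column_sequence xs \<and> xs \<noteq> [] \<and> fst (xs ! 0) = 0 \<and>
    (\<forall>i z. Q i z \<longleftrightarrow> i < length xs \<and> fst (xs ! i) \<le> z \<and> z \<le> snd (xs ! i))"
proof -
  define C where "C = {i. \<exists>z. Q i z}"
  define w where "w = Suc (Max C)"
  define b t where "b i = Min {z. Q i z}" and "t i = Max {z. Q i z}" for i
  have finC: "finite C"
    by (rule finite_subset[OF _ finite_imageI[OF fin, of fst]]) (force simp: C_def)
  have fincol: "finite {z. Q i z}" for i
    by (rule finite_subset[OF _ finite_imageI[OF fin, of snd]]) force
  \<comment> \<open>The nonempty columns have no gap: starting in column 0, \<open>Q\<close> could
    not step across an empty column \<open>i\<close>.\<close>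
  have "i \<in> C" if "i < w" for i
  proof (rule ccontr)
    assume "i \<notin> C"
    then have empty: "\<not> Q i z" for z by (auto simp: C_def)
    have "i \<noteq> 0" using origin empty[of 0] by metis
    have "Max C \<in> C"
      using finC origin by (intro Max_in) (auto simp: C_def)
    then obtain z where "Q (Max C) z" by (auto simp: C_def)
    then have "Max C < i"
    proof (rule cut[where R = "\<lambda>j z. j < i", rotated -1])
      show "0 < i" using \<open>i \<noteq> 0\<close> by simp
      show "Suc j < i" if "j < i" "Q (Suc j) z" for j z
        using that empty by (metis Suc_lessI)
    qed auto
    with that show False by (simp add: w_def)
  qed
  moreover have "i < w" if "i \<in> C" for i
    using that finC by (simp add: w_def le_imp_less_Suc)
  ultimately have C: "i \<in> C \<longleftrightarrow> i < w" for i by blast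
  have Qbt: "Q i (b i)" "Q i (t i)" if "i < w" for i
  proof -
    from that have "{z. Q i z} \<noteq> {}" using C[of i] by (auto simp: C_def)
    then show "Q i (b i)" "Q i (t i)"
      using Min_in[OF fincol] Max_in[OF fincol] unfolding b_def t_def by blast+
  qed
  have bt: "b i \<le> z \<and> z \<le> t i" if "Q i z" for i z
    using that fincol unfolding b_def t_def by simp
  have Q: "Q i z \<longleftrightarrow> i < w \<and> b i \<le> z \<and> z \<le> t i" for i z
    using bt[of i z] Qbt[of i] col[of i "b i" "t i" z] C[of i] by (auto simp: C_def)
  have w: "0 < w" by (simp add: w_def)
  \<comment> \<open>Otherwise row \<open>b (Suc i)\<close> and column \<open>i\<close> bound a north-east quadrant that \<open>Q\<close> cannot leave.\<close>
  have mono: "b i \<le> b (Suc i)" if "Suc i < w" for i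
  proof (rule ccontr)
    assume less: "\<not> b i \<le> b (Suc i)"
    have "Suc i \<le> i \<and> b (Suc i) \<le> b (Suc i)"
    proof (rule cut[where R = "\<lambda>j z. j \<le> i \<and> z \<le> b (Suc i)"])
      show "Q (Suc i) (b (Suc i))" using Qbt that by blast
      fix j z
      show "Suc j \<le> i \<and> z \<le> b (Suc i)" if "j \<le> i \<and> z \<le> b (Suc i)" "Q j z"
        using that less bt[of j z] by (cases "j = i") auto
      show "j \<le> i \<and> Suc z \<le> b (Suc i)" if R: "j \<le> i \<and> z \<le> b (Suc i)" "Q j z"
      proof (cases "z = b (Suc i)")
        case True
        then have "Q i z"
          using row[of j z "Suc i" i] R Qbt(1)[OF \<open>Suc i < w\<close>] by simp
        with True less bt[of i z] show ?thesis by simp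
      qed (use R in auto)
    qed auto
    then show False by simp
  qed
  \<comment> \<open>Otherwise columns \<open>i\<close> and \<open>Suc i\<close> share no depth, so
    \<open>Q\<close> could not leave the columns up to \<open>i\<close>.\<close>
  have overlap: "b (Suc i) \<le> t i" if "Suc i < w" for i
  proof (rule ccontr)
    assume less: "\<not> b (Suc i) \<le> t i"
    have "Suc i \<le> i"
    proof (rule cut[where R = "\<lambda>j z. j \<le> i"])
      show "Q (Suc i) (b (Suc i))" using Qbt that by blast
      show "Suc j \<le> i" if "j \<le> i" "Q j z" "Q (Suc j) z" for j z
        using that less bt[of j z] bt[of "Suc j" z] by (cases "j = i") auto
    qed auto
    then show False by simp
  qed
  have bmono: "b i \<le> b j" if "i \<le> j" "j < w" for i j
    using that
  proof (induction rule: dec_induct)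
    case (step n)
    then show ?case using mono[of n] by simp
  qed simp
  have unimodal: "min (t i) (t k) \<le> t j" if "i \<le> j" "j \<le> k" "k < w" for i j k
  proof (rule ccontr)
    assume "\<not> min (t i) (t k) \<le> t j"
    then have less: "t j < t i" "t j < t k" by auto
    have "t k \<le> t j"
      using that(2,3)
    proof (induction rule: dec_induct)
      case (step n)
      \<comment> \<open>Suppose \<open>Suc n\<close> is the first column reaching below depth
        \<open>t j\<close>. By overlap it contains depth \<open>t j + 1\<close>, as does column
        \<open>i\<close>; row convexity then puts this depth into column \<open>j\<close>.\<close>
      show ?case
      proof (rule ccontr)
        assume above: "\<not> t (Suc n) \<le> t j"
        have "b (Suc n) \<le> t n" "t n \<le> t j"
          using overlap[of n] step by auto
        then have "Q (Suc n) (Suc (t j))"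
          unfolding Q using above step.prems by simp
        moreover have "b i \<le> b j" "b j \<le> t j"
          using bmono[of i j] Qbt(2)[of j] bt that step.hyps step.prems by auto
        then have "Q i (Suc (t j))"
          unfolding Q using that less(1) by simp
        ultimately have "Q j (Suc (t j))"
          using row[of i "Suc (t j)" "Suc n" j] that(1) step.hyps by simp
        then show False using bt[of j "Suc (t j)"] by simp
      qed
    qed simp
    with less show False by simp
  qed
  define xs where "xs = map (\<lambda>i. (b i, t i)) [0..<w]"
  have len: "length xs = w" by (simp add: xs_def)
  have nth: "xs ! i = (b i, t i)" if "i < w" for i
    using that by (simp add: xs_def)
  have le: "b i \<le> t i" if "i < w" for i
    using bt Qbt(1)[OF that] by blast
  have "column_sequence xs"
    unfolding column_sequence_def
  proof (intro conjI allI impI)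
    show "fst (xs ! i) \<le> snd (xs ! i)" if "i < length xs" for i
      using that le[of i] by (simp add: nth len)
    show "fst (xs ! i) \<le> fst (xs ! Suc i)" "fst (xs ! Suc i) \<le> snd (xs ! i)" if "Suc i < length xs" for i
      using that mono[of i] overlap[of i] by (simp_all add: nth len)
    show "min (snd (xs ! i)) (snd (xs ! k)) \<le> snd (xs ! j)" if "i \<le> j" "j \<le> k" "k < length xs" for i j k
      using unimodal[of i j k] that by (simp add: nth len)
  qed
  moreover have "xs \<noteq> []" using len w by auto
  moreover have "fst (xs ! 0) = 0"
    using bt[OF origin] by (simp add: nth w)
  moreover have "Q i z \<longleftrightarrow> i < length xs \<and> fst (xs ! i) \<le> z \<and> z \<le> snd (xs ! i)" for i z
    unfolding len Q using nth[of i] by auto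
  ultimately show ?thesis by blast
qed

lemma convex_polyomino_between:
  assumes "convex_polyomino P"
  shows "(x1, y) \<in> P \<Longrightarrow> (x3, y) \<in> P \<Longrightarrow> x1 \<le> x2 \<Longrightarrow> x2 \<le> x3 \<Longrightarrow> (x2, y) \<in> P"
    and "(x, y1) \<in> P \<Longrightarrow> (x, y3) \<in> P \<Longrightarrow> y1 \<le> y2 \<Longrightarrow> y2 \<le> y3 \<Longrightarrow> (x, y2) \<in> P"
proof -
  assume *: "(x1, y) \<in> P" "(x3, y) \<in> P" "x1 \<le> x2" "x2 \<le> x3"
  obtain l r where "{x. (x, y) \<in> P} = {l..r}"
    using assms unfolding convex_polyomino_def by blast
  then have "(x, y) \<in> P \<longleftrightarrow> l \<le> x \<and> x \<le> r" for x
    by (metis atLeastAtMost_iff mem_Collect_eq)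
  with * show "(x2, y) \<in> P" by simp
next
  assume *: "(x, y1) \<in> P" "(x, y3) \<in> P" "y1 \<le> y2" "y2 \<le> y3"
  obtain l r where "{y. (x, y) \<in> P} = {l..r}"
    using assms unfolding convex_polyomino_def by blast
  then have "(x, y) \<in> P \<longleftrightarrow> l \<le> y \<and> y \<le> r" for y
    by (metis atLeastAtMost_iff mem_Collect_eq)
  with * show "(x, y2) \<in> P" by simp
qed

abbreviation translate :: "int \<Rightarrow> int \<Rightarrow> cell set \<Rightarrow> cell set" where
  "translate d e P \<equiv> (\<lambda>(x, y). (x + d, y + e)) ` P"

text \<open>Rectangularity puts the corner \<open>(X, Y)\<close> of the bounding box into
  \<open>P\<close>. Distances west and south of it turn \<open>P\<close> into a relation on
  naturals, from which the columns are extracted.\<close>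

lemma rectangular_ascending_columns:
  assumes "rectangular_ascending P"
  shows "\<exists>xs d e. column_sequence xs \<and> xs \<noteq> [] \<and> fst (xs ! 0) = 0 \<and> P = translate d e (column_cells xs)"
proof -
  have cvx: "convex_polyomino P"
    using assms by (simp add: rectangular_ascending_def ascending_def)
  then have fin: "finite P" and "P \<noteq> {}" and conn: "edge_connected P"
    by (auto simp: convex_polyomino_def polyomino_def)
  define X Y where "X = Max (fst ` P)" and "Y = Max (snd ` P)"
  define Q where "Q i z \<longleftrightarrow> (X - int i, Y - int z) \<in> P" for i z
  have le: "x \<le> X" "y \<le> Y" if "(x, y) \<in> P" for x y
    unfolding X_def Y_def using fin that by (auto intro!: Max_ge rev_image_eqI)
  have "finite {y. (X, y) \<in> P}"
    by (rule finite_subset[OF _ finite_imageI[OF fin, of snd]]) force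
  moreover have "X \<in> fst ` P"
    unfolding X_def using fin \<open>P \<noteq> {}\<close> by (intro Max_in) auto
  then have "{y. (X, y) \<in> P} \<noteq> {}" by auto
  ultimately have "Max {y. (X, y) \<in> P} \<in> {y. (X, y) \<in> P}"
    by (rule Max_in)
  moreover have "Max {y. (X, y) \<in> P} = Y"
    using assms unfolding rectangular_ascending_def rightmost_column_top_def X_def Y_def by simp
  ultimately have corner: "(X, Y) \<in> P" by simp
  have P_iff: "(x, y) \<in> P \<longleftrightarrow> x \<le> X \<and> y \<le> Y \<and> Q (nat (X - x)) (nat (Y - y))" for x y
    using le[of x y] by (auto simp: Q_def)
  have "\<exists>xs. column_sequence xs \<and> xs \<noteq> [] \<and> fst (xs ! 0) = 0 \<and>
    (\<forall>i z. Q i z \<longleftrightarrow> i < length xs \<and> fst (xs ! i) \<le> z \<and> z \<le> snd (xs ! i))"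
  proof (rule ex_column_sequence)
    show "Q 0 0" using corner by (simp add: Q_def)
    have "{(i, z). Q i z} \<subseteq> (\<lambda>(x, y). (nat (X - x), nat (Y - y))) ` P"
    proof (safe)
      fix i z assume "Q i z"
      then show "(i, z) \<in> (\<lambda>(x, y). (nat (X - x), nat (Y - y))) ` P"
        unfolding Q_def by (rule rev_image_eqI) simp
    qed
    then show "finite {(i, z). Q i z}"
      using fin by (meson finite_imageI finite_subset)
    \<comment> \<open>Depth reverses the order of \<open>y\<close>, so the two outer cells swap
      roles; the same happens in rows.\<close>
    show "Q i z2" if "Q i z1" "Q i z3" "z1 \<le> z2" "z2 \<le> z3" for i z1 z2 z3
      using that convex_polyomino_between(2)[OF cvx, of "X - int i" "Y - int z3" "Y - int z1" "Y - int z2"]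
      by (simp add: Q_def)
    show "Q i2 z" if "Q i1 z" "Q i3 z" "i1 \<le> i2" "i2 \<le> i3" for i1 i2 i3 z
      using that convex_polyomino_between(1)[OF cvx, of "X - int i3" "Y - int z" "X - int i1" "X - int i2"]
      by (simp add: Q_def)
    fix R i z
    assume R: "R 0 0"
      "\<And>i z. R i z \<Longrightarrow> Q i z \<Longrightarrow> Q (Suc i) z \<Longrightarrow> R (Suc i) z"
      "\<And>i z. R (Suc i) z \<Longrightarrow> Q (Suc i) z \<Longrightarrow> Q i z \<Longrightarrow> R i z"
      "\<And>i z. R i z \<Longrightarrow> Q i z \<Longrightarrow> Q i (Suc z) \<Longrightarrow> R i (Suc z)"
      "\<And>i z. R i (Suc z) \<Longrightarrow> Q i (Suc z) \<Longrightarrow> Q i z \<Longrightarrow> R i z"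
      and "Q i z"
    have "P \<subseteq> {(x, y). R (nat (X - x)) (nat (Y - y))}"
    proof (rule edge_connected_cut[OF conn corner])
      show "(X, Y) \<in> {(x, y). R (nat (X - x)) (nat (Y - y))}"
        using R(1) by simp
      fix u v assume uv: "u \<in> {(x, y). R (nat (X - x)) (nat (Y - y))}" "u \<in> P" "v \<in> P" "edge_adjacent u v"
      obtain x y x' y' where eq: "u = (x, y)" "v = (x', y')" by fastforce
      have Ru: "R (nat (X - x)) (nat (Y - y))" using uv(1) eq by simp
      have Qu: "Q (nat (X - x)) (nat (Y - y))" "x \<le> X" "y \<le> Y" using uv(2) eq P_iff by auto
      have Qv: "Q (nat (X - x')) (nat (Y - y'))" "x' \<le> X" "y' \<le> Y" using uv(3) eq P_iff by auto
      \<comment> \<open>The four neighbours correspond to the four closure rules for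
        \<open>R\<close>.\<close>
      have "x' = x - 1 \<and> y' = y \<or> x' = x + 1 \<and> y' = y \<or> x' = x \<and> y' = y - 1 \<or> x' = x \<and> y' = y + 1"
        using uv(4) unfolding edge_adjacent_def eq fst_conv snd_conv by presburger
      then consider "x' = x - 1" "y' = y" | "x' = x + 1" "y' = y" | "x' = x" "y' = y - 1" | "x' = x" "y' = y + 1"
        by blast
      then have "R (nat (X - x')) (nat (Y - y'))"
      proof cases
        case 1
        then have "nat (X - x') = Suc (nat (X - x))" using Qu(2) by linarith
        then show ?thesis using R(2)[OF Ru Qu(1)] Qv(1) 1(2) by simp
      next
        case 2
        then have "nat (X - x) = Suc (nat (X - x'))" using Qv(2) by linarith
        then show ?thesis using R(3)[of "nat (X - x')" "nat (Y - y)"] Ru Qu(1) Qv(1) 2(2) by simp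
      next
        case 3
        then have "nat (Y - y') = Suc (nat (Y - y))" using Qu(3) by linarith
        then show ?thesis using R(4)[OF Ru Qu(1)] Qv(1) 3(1) by simp
      next
        case 4
        then have "nat (Y - y) = Suc (nat (Y - y'))" using Qv(3) by linarith
        then show ?thesis using R(5)[of "nat (X - x)" "nat (Y - y')"] Ru Qu(1) Qv(1) 4(1) by simp
      qed
      then show "v \<in> {(x, y). R (nat (X - x)) (nat (Y - y))}" using eq by simp
    qed
    moreover have "(X - int i, Y - int z) \<in> P"
      using \<open>Q i z\<close> by (simp add: Q_def)
    ultimately show "R i z" by auto
  qed
  then obtain xs where xs: "column_sequence xs" "xs \<noteq> []" "fst (xs ! 0) = 0"
    and Q: "\<And>i z. Q i z \<longleftrightarrow> i < length xs \<and> fst (xs ! i) \<le> z \<and> z \<le> snd (xs ! i)"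
    by blast
  have "P = translate X Y (column_cells xs)"
  proof (intro set_eqI, clarify)
    fix x y
    have "(x, y) \<in> P \<longleftrightarrow> (x - X, y - Y) \<in> column_cells xs"
      unfolding P_iff mem_column_cells Q by simp
    also have "\<dots> \<longleftrightarrow> (x, y) \<in> translate X Y (column_cells xs)"
      by (auto simp: image_iff intro!: bexI[of _ "(x - X, y - Y)"])
    finally show "(x, y) \<in> P \<longleftrightarrow> (x, y) \<in> translate X Y (column_cells xs)" .
  qed
  with xs show ?thesis by blast
qed

section \<open>Counting classes up to translation\<close>

lemma equiv_translation_rel: "equiv UNIV translation_rel"
proof (rule equivI)
  show "translation_rel \<subseteq> UNIV \<times> UNIV" by simp
  show "refl translation_rel"
    unfolding refl_on_def translation_rel_def by (auto intro!: exI[of _ 0])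
  show "sym translation_rel"
  proof (rule symI)
    fix P Q assume "(P, Q) \<in> translation_rel"
    then obtain d e where "Q = translate d e P" by (auto simp: translation_rel_def)
    then have "P = translate (- d) (- e) Q"
      by (force simp: image_image case_prod_beta)
    then show "(Q, P) \<in> translation_rel" unfolding translation_rel_def by blast
  qed
  show "trans translation_rel"
  proof (rule transI)
    fix P Q S assume "(P, Q) \<in> translation_rel" "(Q, S) \<in> translation_rel"
    then obtain d e d' e' where "Q = translate d e P" "S = translate d' e' Q"
      by (auto simp: translation_rel_def)
    then have "S = translate (d + d') (e + e') P"
      by (simp add: image_image case_prod_beta add.assoc)
    then show "(P, S) \<in> translation_rel" unfolding translation_rel_def by blast
  qed
qed

lemma translate_extrema:
  assumes "finite P" "P \<noteq> {}"
  shows "Max (fst ` translate d e P) = Max (fst ` P) + d" "Max (snd ` translate d e P) = Max (snd ` P) + e"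
    "Min (fst ` translate d e P) = Min (fst ` P) + d" "Min (snd ` translate d e P) = Min (snd ` P) + e"
proof -
  have "fst ` translate d e P = (\<lambda>x. x + d) ` fst ` P" "snd ` translate d e P = (\<lambda>x. x + e) ` snd ` P"
    by (simp_all add: image_image case_prod_beta)
  moreover have "mono (\<lambda>x. x + c)" for c :: int
    by (simp add: mono_def)
  ultimately show "Max (fst ` translate d e P) = Max (fst ` P) + d" "Max (snd ` translate d e P) = Max (snd ` P) + e"
    "Min (fst ` translate d e P) = Min (fst ` P) + d" "Min (snd ` translate d e P) = Min (snd ` P) + e"
    using assms mono_Max_commute mono_Min_commute by (metis finite_imageI image_is_empty)+
qed

lemma semi_perimeter_translate:
  "finite P \<Longrightarrow> P \<noteq> {} \<Longrightarrow> semi_perimeter (translate d e P) = semi_perimeter P"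
  unfolding semi_perimeter_def width_def height_def by (subst translate_extrema; simp)+

text \<open>Each class contains exactly one \<open>column_cells xs\<close>: both coordinate maxima
  of such a set are 0, which leaves only the zero translation between two of them.\<close>

lemma num_rectangular_ascending_eq:
  "num_rectangular_ascending n =
     card {xs. column_sequence xs \<and> xs \<noteq> [] \<and> fst (xs ! 0) = 0 \<and> semi_perimeter (column_cells xs) = n}"
    (is "_ = card ?L")
proof -
  let ?S = "{P. rectangular_ascending P \<and> semi_perimeter P = n}"
  let ?f = "\<lambda>xs. translation_rel `` {column_cells xs}"
  have "bij_betw ?f ?L (?S // translation_rel)"
  proof (rule bij_betw_imageI)
    show "inj_on ?f ?L"
    proof (rule inj_onI)
      fix xs ys assume xs: "xs \<in> ?L" and ys: "ys \<in> ?L" and "?f xs = ?f ys"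
      then have "(column_cells xs, column_cells ys) \<in> translation_rel"
        using eq_equiv_class[OF _ equiv_translation_rel] by blast
      then obtain d e where de: "column_cells ys = translate d e (column_cells xs)"
        by (auto simp: translation_rel_def)
      have "column_cells xs \<noteq> {}"
        using origin_in_column_cells xs by blast
      then have "d = 0" "e = 0"
        using translate_extrema(1,2)[OF finite_column_cells, of xs d e, folded de] xs ys
        by (simp_all add: column_cells_Max)
      then have "column_cells xs = column_cells ys"
        using de by simp
      then show "xs = ys"
        using column_cells_inj xs ys by blast
    qed
    show "?f ` ?L = ?S // translation_rel"
    proof (intro equalityI subsetI)
      fix c assume "c \<in> ?f ` ?L"
      then show "c \<in> ?S // translation_rel"
        using rectangular_ascending_column_cells by (auto intro!: quotientI)
    next
      fix c assume "c \<in> ?S // translation_rel"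
      then obtain P where P: "rectangular_ascending P" "semi_perimeter P = n" and c: "c = translation_rel `` {P}"
        by (auto elim!: quotientE)
      obtain xs d e where xs: "column_sequence xs" "xs \<noteq> []" "fst (xs ! 0) = 0"
        and eq: "P = translate d e (column_cells xs)"
        using rectangular_ascending_columns[OF P(1)] by blast
      have "column_cells xs \<noteq> {}"
        using origin_in_column_cells xs by blast
      then have "semi_perimeter (column_cells xs) = n"
        using P(2) semi_perimeter_translate[OF finite_column_cells] eq by simp
      moreover have "(column_cells xs, P) \<in> translation_rel"
        using eq by (auto simp: translation_rel_def)
      then have "?f xs = c"
        unfolding c by (rule equiv_class_eq[OF equiv_translation_rel])
      ultimately show "c \<in> ?f ` ?L"
        using xs by blast
    qed
  qed
  then show ?thesis
    unfolding num_rectangular_ascending_def by (simp add: bij_betw_same_card)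
qed

text \<open>With \<open>W\<close> columns after the first and largest depth \<open>H\<close>, the
  semi-perimeter is \<open>(W + 1) + (H + 1)\<close>, hence \<open>H = m - W\<close>.\<close>

lemma column_sequences_of_semi_perimeter:
  "{xs. column_sequence xs \<and> xs \<noteq> [] \<and> fst (xs ! 0) = 0 \<and> semi_perimeter (column_cells xs) = m + 2} =
     (\<lambda>(W, t, ys). (0, t) # ys) ` (SIGMA W:{..m}. SIGMA t:{..m - W}. column_tails (m - W) W 0 t)"
    (is "?L = ?g ` ?R")
proof (intro equalityI subsetI)
  fix xs assume xs: "xs \<in> ?L"
  then obtain t ys where eq: "xs = (0, t) # ys"
    by (cases xs) auto
  define H where "H = Max (snd ` set xs)"
  have H: "\<forall>y\<in>set xs. snd y \<le> H" "H \<in> snd ` set xs"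
    unfolding H_def eq by (auto intro!: Max_ge Max_in[of "snd ` set ((0, t) # ys)", simplified])
  then have "length xs + Suc H = m + 2"
    using semi_perimeter_column_cells[of xs H] xs by simp
  then have "length ys \<le> m" "H = m - length ys"
    by (auto simp: eq)
  moreover have "columns_from H 0 t ys"
    using xs H unfolding columns_from_iff_column_sequence eq by blast
  moreover have "t \<le> H"
    using H(1) by (simp add: eq)
  ultimately have "(length ys, t, ys) \<in> ?R" by simp
  then show "xs \<in> ?g ` ?R"
    unfolding eq by (rule rev_image_eqI) simp
next
  fix xs assume "xs \<in> ?g ` ?R"
  then obtain t ys where eq: "xs = (0, t) # ys" and "length ys \<le> m" "columns_from (m - length ys) 0 t ys"
    by auto
  then show "xs \<in> ?L"
    using semi_perimeter_column_cells[of xs "m - length ys"]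
    unfolding columns_from_iff_column_sequence by simp
qed

text \<open>Each split \<open>W + H = m\<close> contributes \<open>(m choose W) ^ 2\<close>.\<close>

lemma num_rectangular_ascending_binomial: "num_rectangular_ascending (m + 2) = (2 * m) choose m"
proof -
  let ?R = "SIGMA W:{..m}. SIGMA t:{..m - W}. column_tails (m - W) W 0 t"
  have "inj_on (\<lambda>(W, t, ys). (0 :: nat, t) # ys) ?R"
    by (auto simp: inj_on_def)
  then have "num_rectangular_ascending (m + 2) = card ?R"
    unfolding num_rectangular_ascending_eq column_sequences_of_semi_perimeter by (rule card_image)
  also have "\<dots> = (\<Sum>W\<le>m. \<Sum>t\<le>m - W. card (column_tails (m - W) W 0 t))"
    by (simp add: card_SigmaI finite_column_tails finite_SigmaI)
  also have "\<dots> = (\<Sum>W\<le>m. (m choose W) ^ 2)"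
    by (intro sum.cong refl) (simp add: sum_card_column_tails_box)
  also have "\<dots> = (2 * m) choose m"
    by (rule choose_square_sum)
  finally show ?thesis .
qed

lemma num_rectangular_ascending_small:
  assumes "n < 2"
  shows "num_rectangular_ascending n = 0"
proof -
  have "2 \<le> semi_perimeter (column_cells xs)" if "column_sequence xs" "xs \<noteq> []" "fst (xs ! 0) = 0" for xs
  proof -
    have "finite (snd ` set xs)" "snd ` set xs \<noteq> {}"
      using that by auto
    then have "semi_perimeter (column_cells xs) = length xs + Suc (Max (snd ` set xs))"
      using that by (intro semi_perimeter_column_cells) auto
    moreover have "length xs \<noteq> 0" using that by simp
    ultimately show ?thesis by linarith
  qed
  then have empty: "{xs. column_sequence xs \<and> xs \<noteq> [] \<and> fst (xs ! 0) = 0 \<and> semi_perimeter (column_cells xs) = n} = {}"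
    using assms by fastforce
  show ?thesis
    unfolding num_rectangular_ascending_eq empty by simp
qed

theorem theorem4:
  shows "(\<forall>n\<ge>2. num_rectangular_ascending n = (2 * n - 4) choose (n - 2)) \<and>
    rectangular_ascending_gf = fps_X ^ 2 / fps_radical root 2 (1 - 4 * fps_X)"
proof
  show "\<forall>n\<ge>2. num_rectangular_ascending n = (2 * n - 4) choose (n - 2)"
  proof (intro allI impI)
    fix n :: nat assume "2 \<le> n"
    then obtain m where "n = m + 2"
      by (metis add.commute le_Suc_ex)
    then show "num_rectangular_ascending n = (2 * n - 4) choose (n - 2)"
      using num_rectangular_ascending_binomial[of m] by simp
  qed
  let ?F = "Abs_fps (\<lambda>n. real ((2 * n) choose n))" and ?R = "fps_radical root 2 (1 - 4 * fps_X :: real fps)"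
  \<comment> \<open>The factor \<open>fps_X ^ 2\<close> is the shift \<open>n = m + 2\<close>; the
    coefficients for \<open>n < 2\<close> vanish on both sides.\<close>
  have "rectangular_ascending_gf = fps_X ^ 2 * ?F"
  proof (rule fps_ext)
    fix n
    show "fps_nth rectangular_ascending_gf n = fps_nth (fps_X ^ 2 * ?F) n"
    proof (cases "n < 2")
      case True
      then show ?thesis
        by (simp add: rectangular_ascending_gf_def fps_X_power_mult_nth num_rectangular_ascending_small)
    next
      case False
      then obtain m where "n = m + 2"
        by (metis add.commute le_Suc_ex not_less)
      then show ?thesis
        using num_rectangular_ascending_binomial[of m]
        by (simp add: rectangular_ascending_gf_def fps_X_power_mult_nth)
    qed
  qed
  also have "?F = inverse ?R"
    by (rule fps_inverse_unique[symmetric]) (subst mult.commute, rule central_binomial_fps)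
  also have "fps_X ^ 2 * inverse ?R = fps_X ^ 2 / ?R"
    by (rule fps_divide_unit[symmetric]) (simp add: numeral_2_eq_2)
  finally show "rectangular_ascending_gf = fps_X ^ 2 / ?R" .
qed

end
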